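(* Let $\mathbb A=(A,+)$ be a cancellative semigroup (not necessarily commutative), and let $X, Y \subseteq A$ be such that $\langle Y \rangle$ is commutative and $Y \neq \emptyset$. Then at least one of the following holds: (i) $|X+Y| \ge |X| + \min(\gamma(Y), |Y|-1)$; (ii) $X + 2Y = X + Y + \bar y$ for some $\bar y \in Y^\times$.
   Context: The semigroup is written additively, but "additive" does not imply commutative. An element $z$ is cancellable if $x\mapsto x+z$ and $x\mapsto z+x$ are both injective on $A$; $\mathbb A$ is cancellative if every element is cancellable. For $X_1,\dots,X_n\subseteq A$, $X_1+\cdots+X_n:=\{x_1+\cdots+x_n : x_i\in X_i\}$; a singleton $\{x\}$ is written $x$, and $2Y := Y+Y$. $\mathbb A^\times$ is the set of units (invertible elements; this requires $\mathbb A$ to be a monoid, otherwise it is empty), and $X^\times := X\cap \mathbb A^\times$. For $X\subseteq A$ and a unit $y$, $X-y:=\{x+(-y): x\in X\}$, where $-y$ is the inverse of $y$. $\langle X\rangle$ denotes the subsemigroup generated by $X$, and $\mathrm{ord}(X):=|\langle X\rangle|$, with $\mathrm{ord}(x):=\mathrm{ord}(\{x\})$; cardinalities may be infinite. For $X\subseteq A$: $\gamma(X):=|X|$ if $|X|\le 1$, and otherwise $\gamma(X):=\sup_{x_0\in X^\times}\inf_{x\in X,\,x\neq x_0}\mathrm{ord}(x-x_0)$, with the conventions $\sup\emptyset=0$ and $\inf\emptyset=\infty$. *)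

theory Defs
  imports "HOL-Library.Set_Algebras" "HOL-Library.Extended_Nat"
begin

unbundle cardinal_syntax

inductive_set subsemigroup_gen :: "'a::semigroup_add set \<Rightarrow> 'a set" for X where
  base: "x \<in> X \<Longrightarrow> x \<in> subsemigroup_gen X"
| add: "x \<in> subsemigroup_gen X \<Longrightarrow> y \<in> subsemigroup_gen X \<Longrightarrow> x + y \<in> subsemigroup_gen X"

text \<open>The semigroup need not have a neutral element; if it has none, the set of units is empty.\<close>

definition is_neutral :: "'a::semigroup_add \<Rightarrow> bool" where
  "is_neutral e \<longleftrightarrow> (\<forall>a. e + a = a \<and> a + e = a)"

definition is_inverse :: "'a::semigroup_add \<Rightarrow> 'a \<Rightarrow> bool" where
  "is_inverse x y \<longleftrightarrow> is_neutral (x + y) \<and> is_neutral (y + x)"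

definition semigroup_units :: "'a::semigroup_add set" where
  "semigroup_units = {x. \<exists>y. is_inverse x y}"

definition unit_inv :: "'a::semigroup_add \<Rightarrow> 'a" where
  "unit_inv x = (THE y. is_inverse x y)"

lemma is_inverse_unique:
  assumes "is_inverse x y" and "is_inverse x z"
  shows "y = z"
proof -
  have "y = y + (x + z)" using assms by (simp add: is_inverse_def is_neutral_def)
  also have "\<dots> = (y + x) + z" by (simp only: add.assoc)
  also have "\<dots> = z" using assms by (simp add: is_inverse_def is_neutral_def)
  finally show ?thesis .
qed

lemma is_inverse_unit_inv:
  assumes "x \<in> semigroup_units"
  shows "is_inverse x (unit_inv x)"
proof -
  obtain y where y: "is_inverse x y" using assms unfolding semigroup_units_def by blast
  then show ?thesis unfolding unit_inv_def by (rule theI) (rule is_inverse_unique[OF _ y])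
qed

definition ecard :: "'a set \<Rightarrow> enat" where
  "ecard X = (if finite X then enat (card X) else \<infinity>)"

definition semigroup_ord :: "'a::semigroup_add set \<Rightarrow> enat" where
  "semigroup_ord X = ecard (subsemigroup_gen X)"

text \<open>
  Only orders of single elements enter the following definition. These are countable cardinals,
  so that with \<open>\<infinity>\<close> read as the cardinality of the natural numbers no information is lost in
  \<^typ>\<open>enat\<close>. In this type \<open>Sup {} = 0\<close> and \<open>Inf {} = \<infinity>\<close>.
\<close>

definition gamma :: "'a::semigroup_add set \<Rightarrow> enat" where
  "gamma X = (if ecard X \<le> 1 then ecard X
     else (SUP x0 \<in> X \<inter> semigroup_units. INF x \<in> X - {x0}. semigroup_ord {x + unit_inv x0}))"

text \<open>The cardinal number (finite, or that of the natural numbers) denoted by an extended natural.\<close>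

definition cardinal_of_enat :: "enat \<Rightarrow> nat rel" where
  "cardinal_of_enat n = |{k. enat k < n}|"

end

theory Submission
  imports Defs
begin

text \<open>
  If \<open>X\<close> or \<open>Y\<close> is infinite, or \<open>Y\<close> has no suitable unit, the claim is immediate. Otherwise
  translate \<open>Y\<close> by a unit attaining \<open>\<gamma>(Y)\<close>, so that \<open>0 \<in> Y\<close>, and suppose \<open>X + 2Y \<noteq> X + Y\<close>.
  Take \<open>z \<in> X + 2Y\<close> outside \<open>X + Y\<close> and split \<open>Y\<close> into \<open>D = {y \<in> Y. z \<in> X + Y + y}\<close> and
  \<open>Z = Y - D\<close>, where \<open>0 \<in> Z\<close> (the Davenport transform). The elements \<open>z - y\<close> with \<open>y \<in> D\<close> lie
  in \<open>X + Y\<close> but not in \<open>X + Z\<close>, so \<open>|X + Y| \<ge> |X + Z| + |D|\<close>, and one inducts on \<open>|Y|\<close>.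
  The induction stops when \<open>X + 2Z = X + Z\<close>. Then \<open>X + Z = X + H\<close> with \<open>H = \<langle>Z\<rangle>\<close>
  finite, and for some \<open>x \<in> X\<close>, \<open>y \<in> Y\<close> the set \<open>(X \<inter> (x + H)) + y\<close> avoids \<open>X + H\<close>; since
  \<open>X + H\<close> contains both \<open>X\<close> and \<open>x + H\<close>, this gives \<open>|X + Y| \<ge> |X| + |H|\<close>.
\<close>

lemma commute_subsemigroup_gen:
  fixes a :: "'a::semigroup_add"
  assumes "b \<in> subsemigroup_gen Z" and "\<And>z. z \<in> Z \<Longrightarrow> a + z = z + a"
  shows "a + b = b + a"
  using assms(1) by induction (use assms(2) in simp, metis add.assoc)

lemma subsemigroup_gen_mono:
  assumes "Y \<subseteq> Z"
  shows "subsemigroup_gen Y \<subseteq> subsemigroup_gen Z"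
proof
  fix b assume "b \<in> subsemigroup_gen Y"
  then show "b \<in> subsemigroup_gen Z"
    by induction (use assms in \<open>auto intro: subsemigroup_gen.intros\<close>)
qed

lemma add_subsemigroup_gen_closed:
  fixes B :: "'a::semigroup_add set"
  assumes "h \<in> subsemigroup_gen Z" and "B + Z \<subseteq> B" and "b \<in> B"
  shows "b + h \<in> B"
  using assms(1,3)
proof (induction arbitrary: b)
  case (base h)
  then show ?case using assms(2) by blast
next
  case (add h k)
  then show ?case by (metis add.assoc)
qed

lemma card_le_card_plus:
  fixes X Y :: "'a::cancel_semigroup_add set"
  assumes "y \<in> Y"
  shows "|X| \<le>o |X + Y|"
proof (rule card_of_ordLeqI[where f = "\<lambda>x. x + y"])
  show "inj_on (\<lambda>x. x + y) X" by (auto intro: inj_onI)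
qed (use assms in blast)

lemma finite_of_finite_plus:
  fixes X Y :: "'a::cancel_semigroup_add set"
  assumes "finite (X + Y)" and "X \<noteq> {}" and "Y \<noteq> {}"
  shows "finite X" and "finite Y"
proof -
  obtain x y where xy: "x \<in> X" "y \<in> Y" using assms by blast
  have "(\<lambda>a. a + y) ` X \<subseteq> X + Y" "(+) x ` Y \<subseteq> X + Y" using xy by blast+
  then have "finite ((\<lambda>a. a + y) ` X)" "finite ((+) x ` Y)"
    using assms(1) finite_subset by blast+
  then show "finite X" "finite Y"
    by (auto dest!: finite_imageD intro: inj_onI)
qed

text \<open>Terminal case of the induction. Stability of \<open>X + Z\<close> under adding elements
  of \<open>?H\<close> puts a whole translate \<open>?xH\<close> inside it, so \<open>?H\<close> is
  finite; a single failure \<open>x + y \<notin> X + Z\<close> then propagates to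
  \<open>u + y\<close> for all \<open>u\<close> in \<open>?xH\<close>.\<close>

lemma card_plus_ge_card_add_card_gen:
  fixes X Y Z :: "'a::cancel_semigroup_add set"
  assumes fin: "finite X" "finite Y" and neutral: "is_neutral e" and e: "e \<in> Z" and ZY: "Z \<subseteq> Y"
    and comm: "\<And>a b. a \<in> Y \<Longrightarrow> b \<in> Y \<Longrightarrow> a + b = b + a"
    and closed: "X + Z + Z \<subseteq> X + Z" and proper: "\<not> X + Y \<subseteq> X + Z"
  shows "finite (subsemigroup_gen Z)" and "card X + card (subsemigroup_gen Z) \<le> card (X + Y)"
proof -
  let ?H = "subsemigroup_gen Z" and ?B = "X + Z"
  have finXY: "finite (X + Y)" using fin by (rule finite_set_plus)
  have BXY: "?B \<subseteq> X + Y" using ZY by (rule set_plus_mono2[OF order_refl])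
  have finB: "finite ?B" using BXY finXY by (rule finite_subset)
  have BH: "b + h \<in> ?B" if "b \<in> ?B" "h \<in> ?H" for b h
    using that(2) closed that(1) by (rule add_subsemigroup_gen_closed)
  have XB: "X \<subseteq> ?B"
  proof
    fix x assume "x \<in> X"
    then have "x + e \<in> ?B" using e by blast
    then show "x \<in> ?B" using neutral by (simp add: is_neutral_def)
  qed
  obtain x y where x: "x \<in> X" and y: "y \<in> Y" and xy: "x + y \<notin> ?B"
    using proper by (auto elim!: set_plus_elim)
  let ?xH = "(+) x ` ?H"
  have xHB: "?xH \<subseteq> ?B" using XB x BH by blast
  have inj: "inj_on ((+) x) ?H" by (auto intro: inj_onI)
  show finH: "finite ?H"
    using finite_subset[OF xHB finB] inj by (rule finite_imageD)
  have cardxH: "card ?xH = card ?H" using inj by (rule card_image)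
  let ?S = "(\<lambda>u. u + y) ` (X \<inter> ?xH)"
  have cardS: "card ?S = card (X \<inter> ?xH)" by (rule card_image) (auto intro: inj_onI)
  have "?S \<inter> ?B = {}"
  proof (rule ccontr)
    assume "?S \<inter> ?B \<noteq> {}"
    then obtain h where h: "h \<in> ?H" and in_B: "x + h + y \<in> ?B" by blast
    \<comment> \<open>An injective self-map of a finite set is onto, so \<open>x + h + y\<close> has
      the form \<open>b + h\<close> with \<open>b\<close> in \<open>?B\<close>. As \<open>y\<close>
      commutes with \<open>h\<close>, cancelling \<open>h\<close> puts \<open>x + y\<close> into
      \<open>?B\<close>.\<close>
    have "(\<lambda>b. b + h) ` ?B = ?B"
      using finB BH[OF _ h] by (intro endo_inj_surj) (auto intro: inj_onI)
    with in_B obtain b where b: "b \<in> ?B" and eq: "x + h + y = b + h" by (metis imageE)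
    have "y + h = h + y" using h by (rule commute_subsemigroup_gen) (use comm[OF y] ZY in blast)
    then have "(x + y) + h = b + h" using eq by (simp add: add.assoc)
    then show False using b xy by simp
  qed
  then have "card ?S + card ?B = card (?S \<union> ?B)"
    using fin finB by (simp add: card_Un_disjoint)
  also have "\<dots> \<le> card (X + Y)"
    using BXY y finXY by (intro card_mono) blast+
  finally have 1: "card (X \<inter> ?xH) + card ?B \<le> card (X + Y)" using cardS by simp
  \<comment> \<open>The overlap of \<open>X\<close> and \<open>?xH\<close>, lost in their union
    inside \<open>?B\<close>, is regained by \<open>?S\<close> outside \<open>?B\<close>.\<close>
  have "card X + card ?xH = card (X \<union> ?xH) + card (X \<inter> ?xH)"
    using fin finH by (intro card_Un_Int) auto
  moreover have "card (X \<union> ?xH) \<le> card ?B" using XB xHB finB by (intro card_mono) auto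
  ultimately show "card X + card ?H \<le> card (X + Y)" using 1 cardxH by linarith
qed

text \<open>Each removed \<open>y\<close> brings its own solution \<open>w\<close> of
  \<open>w + y = z\<close> in \<open>X + Y\<close>, and commutativity keeps these solutions out of
  \<open>X + (Y - D)\<close>.\<close>

lemma card_plus_ge_of_davenport_transform:
  fixes X Y :: "'a::cancel_semigroup_add set"
  assumes fin: "finite X" "finite Y" and comm: "\<And>a b. a \<in> Y \<Longrightarrow> b \<in> Y \<Longrightarrow> a + b = b + a"
    and D: "D = {y \<in> Y. z \<in> X + Y + {y}}"
  shows "card (X + (Y - D)) + card D \<le> card (X + Y)"
proof -
  have "\<forall>y\<in>D. \<exists>w\<in>X + Y. w + y = z" unfolding D by (auto elim!: set_plus_elim)
  then obtain w where w: "\<And>y. y \<in> D \<Longrightarrow> w y \<in> X + Y \<and> w y + y = z" by metis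
  have "inj_on w D" by (rule inj_onI) (metis w add_left_cancel)
  then have "card (w ` D) = card D" by (rule card_image)
  moreover have "(X + (Y - D)) \<inter> w ` D = {}"
  proof (rule ccontr)
    assume "(X + (Y - D)) \<inter> w ` D \<noteq> {}"
    then obtain y where y: "y \<in> D" and "w y \<in> X + (Y - D)" by blast
    then obtain x y' where x: "x \<in> X" and y': "y' \<in> Y" "y' \<notin> D" and eq: "w y = x + y'"
      by (auto elim!: set_plus_elim)
    have yY: "y \<in> Y" using y D by blast
    \<comment> \<open>Swapping \<open>y\<close> and \<open>y'\<close> shows that \<open>y'\<close>
      also meets the condition defining \<open>D\<close>.\<close>
    have "z = x + y + y'" using w[OF y] eq comm[OF y'(1) yY] by (metis add.assoc)
    then have "z \<in> X + Y + {y'}" using x yY by blast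
    then show False using y' D by blast
  qed
  moreover have fins: "finite (X + Y)" "finite (X + (Y - D))" "finite D"
    using fin D by (auto intro: finite_set_plus)
  ultimately have "card (X + (Y - D)) + card D = card ((X + (Y - D)) \<union> w ` D)"
    by (simp add: card_Un_disjoint)
  also have "\<dots> \<le> card (X + Y)"
    using fins(1) w by (intro card_mono) (auto elim!: set_plus_elim)
  finally show ?thesis .
qed

text \<open>Normalised case. A fixed bound \<open>n\<close> on the orders replaces
  \<open>gamma\<close>, because such a bound passes to every subset of \<open>Y\<close> containing
  \<open>e\<close>, as the induction requires.\<close>

lemma card_plus_ge_neutral:
  fixes X Y :: "'a::cancel_semigroup_add set"
  assumes fin: "finite X" and neutral: "is_neutral e"
    and "finite Y" and "e \<in> Y" and "\<And>a b. a \<in> Y \<Longrightarrow> b \<in> Y \<Longrightarrow> a + b = b + a"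
    and "\<And>y. y \<in> Y - {e} \<Longrightarrow> enat n \<le> semigroup_ord {y}"
    and "\<not> X + (Y + Y) \<subseteq> X + Y"
  shows "card X + min n (card Y - 1) \<le> card (X + Y)"
  using assms(3-)
proof (induction Y rule: finite_psubset_induct)
  case (psubset Y)
  note e = psubset.prems(1) and comm = psubset.prems(2) and ord = psubset.prems(3)
  obtain z where z: "z \<in> X + Y + Y" "z \<notin> X + Y"
    using psubset.prems(4) by (auto simp: add.assoc)
  define D where "D = {y \<in> Y. z \<in> X + Y + {y}}"
  define Z where "Z = Y - D"
  have "e \<notin> D" using z(2) neutral by (auto simp: D_def is_neutral_def elim!: set_plus_elim)
  then have eZ: "e \<in> Z" using e by (simp add: Z_def)
  have DY: "D \<subseteq> Y" by (auto simp: D_def)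
  have "D \<noteq> {}"
  proof -
    obtain w y where "w \<in> X + Y" "y \<in> Y" "z = w + y" using z(1) by (rule set_plus_elim)
    then have "y \<in> D" by (auto simp: D_def)
    then show ?thesis by blast
  qed
  then have ZY: "Z \<subset> Y" using DY by (auto simp: Z_def)
  have finD: "finite D" using DY psubset.hyps by (rule finite_subset)
  have cardY: "card Y = card Z + card D"
    using psubset.hyps DY finD card_mono[OF psubset.hyps DY] by (simp add: Z_def card_Diff_subset)
  have cardD: "card D > 0" using \<open>D \<noteq> {}\<close> finD by (simp add: card_gt_0_iff)
  have step: "card (X + Z) + card D \<le> card (X + Y)"
    unfolding Z_def
    using fin psubset.hyps comm D_def by (rule card_plus_ge_of_davenport_transform)
  show ?case
  proof (cases "X + (Z + Z) \<subseteq> X + Z")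
    case False
    have "card X + min n (card Z - 1) \<le> card (X + Z)"
    proof (rule psubset.IH[OF ZY eZ _ _ False])
      show "a + b = b + a" if "a \<in> Z" "b \<in> Z" for a b using that ZY comm by blast
      show "enat n \<le> semigroup_ord {y}" if "y \<in> Z - {e}" for y using that ZY ord by blast
    qed
    \<comment> \<open>Replacing \<open>Y\<close> by \<open>Z\<close> lowers the minimum by at most
      \<open>card D\<close>, which \<open>step\<close> gives back.\<close>
    then show ?thesis using step cardY by linarith
  next
    case True
    show ?thesis
    \<comment> \<open>For \<open>Z = {e}\<close> no order is available, but then
      \<open>card D = card Y - 1\<close> and \<open>X + Z = X\<close>, so \<open>step\<close> alone
      suffices.\<close>
    proof (cases "Z = {e}")
      case True
      then have "X + Z = X" using neutral by (auto simp: is_neutral_def set_plus_def)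
      then show ?thesis using step cardY True by simp
    next
      case False
      then obtain y where y: "y \<in> Z - {e}" using eZ by blast
      have proper: "\<not> X + Y \<subseteq> X + Z"
      proof
        assume "X + Y \<subseteq> X + Z"
        then have "card (X + Y) \<le> card (X + Z)"
          using fin psubset.hyps ZY
          by (intro card_mono) (auto intro: finite_set_plus finite_subset)
        then show False using step cardD by linarith
      qed
      have closed: "X + Z + Z \<subseteq> X + Z" using True by (simp add: add.assoc)
      note H = card_plus_ge_card_add_card_gen
        [OF fin psubset.hyps neutral eZ psubset_imp_subset[OF ZY] comm closed proper]
      have sub: "subsemigroup_gen {y} \<subseteq> subsemigroup_gen Z"
        using y by (intro subsemigroup_gen_mono) auto
      \<comment> \<open>Finiteness matters here: it turns the order of \<open>y\<close> into an
        honest cardinality that can be compared with that of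
        \<open>subsemigroup_gen Z\<close>.\<close>
      have "enat n \<le> semigroup_ord {y}" using ord y ZY by blast
      moreover have "finite (subsemigroup_gen {y})" using sub H(1) by (rule finite_subset)
      ultimately have "n \<le> card (subsemigroup_gen {y})"
        by (simp add: semigroup_ord_def ecard_def)
      also have "\<dots> \<le> card (subsemigroup_gen Z)" using H(1) sub by (rule card_mono)
      finally show ?thesis using H(2) by linarith
    qed
  qed
qed

text \<open>Right translation by the inverse of \<open>u\<close> moves \<open>u\<close> to the
  neutral element and preserves both cardinalities. The inverse commutes with \<open>Y\<close>
  because \<open>u\<close> does.\<close>

lemma card_plus_ge_unit:
  fixes X Y :: "'a::cancel_semigroup_add set"
  assumes fin: "finite X" "finite Y" and u: "u \<in> Y" "u \<in> semigroup_units"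
    and comm: "\<And>a b. a \<in> Y \<Longrightarrow> b \<in> Y \<Longrightarrow> a + b = b + a"
    and ord: "\<And>y. y \<in> Y - {u} \<Longrightarrow> enat n \<le> semigroup_ord {y + unit_inv u}"
    and neq: "X + (Y + Y) \<noteq> X + Y + {u}"
  shows "card X + min n (card Y - 1) \<le> card (X + Y)"
proof -
  define v where "v = unit_inv u"
  have inv: "is_inverse u v" unfolding v_def using u(2) by (rule is_inverse_unit_inv)
  have cancel: "a + v + u = a" "a + u + v = a" "v + (u + a) = a" "u + (v + a) = a" for a
    using inv by (simp_all add: is_inverse_def is_neutral_def add.assoc)
  let ?t = "\<lambda>a. a + v"
  let ?Y = "?t ` Y"
  have inj: "inj_on ?t B" for B by (auto intro: inj_onI)
  have XY: "X + ?Y = ?t ` (X + Y)"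
    by (auto simp: set_plus_def image_iff) (metis add.assoc)+
  have vcomm: "v + a = a + v" if "a \<in> Y" for a
    using comm[OF that u(1)] cancel by (metis add.assoc)
  have "card X + min n (card ?Y - 1) \<le> card (X + ?Y)"
  proof (rule card_plus_ge_neutral[OF fin(1)])
    show "is_neutral (u + v)" using inv by (simp add: is_inverse_def)
    show "finite ?Y" using fin(2) by simp
    show "u + v \<in> ?Y" using u(1) by blast
    show "a + b = b + a" if "a \<in> ?Y" "b \<in> ?Y" for a b
      using that comm vcomm by (clarsimp) (metis add.assoc)
    show "enat n \<le> semigroup_ord {y}" if "y \<in> ?Y - {u + v}" for y
      using that ord by (auto simp: v_def)
    \<comment> \<open>One inclusion in \<open>neq\<close> is automatic from
      \<open>u \<in> Y\<close>, so only the other one can fail.\<close>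
    show "\<not> X + (?Y + ?Y) \<subseteq> X + ?Y"
    proof
      assume sub: "X + (?Y + ?Y) \<subseteq> X + ?Y"
      have "X + (Y + Y) \<subseteq> X + Y + {u}"
      proof
        fix w assume "w \<in> X + (Y + Y)"
        then obtain x a b where w: "x \<in> X" "a \<in> Y" "b \<in> Y" "w = x + (a + b)"
          by (auto elim!: set_plus_elim)
        have "x + (?t a + ?t b) \<in> X + ?Y" using sub w by blast
        then obtain c where c: "c \<in> X + Y" and eq: "x + (?t a + ?t b) = c + v"
          unfolding XY by blast
        have "w + v + v = c + v"
          using eq vcomm[OF w(3)] w(4) by (metis add.assoc)
        then have "w = c + u" using cancel(1) by (metis add_right_cancel)
        then show "w \<in> X + Y + {u}" using c by blast
      qed
      moreover have "X + Y + {u} \<subseteq> X + (Y + Y)"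
        unfolding add.assoc using u(1) by (intro set_plus_mono2) auto
      ultimately show False using neq by blast
    qed
  qed
  then show ?thesis unfolding XY by (simp add: card_image[OF inj])
qed

theorem theorem2:
  fixes X Y :: "'a::cancel_semigroup_add set"
  assumes "\<forall>a\<in>subsemigroup_gen Y. \<forall>b\<in>subsemigroup_gen Y. a + b = b + a"
    and "Y \<noteq> {}"
  shows "|X| +c cardinal_of_enat (min (gamma Y) (ecard Y - 1)) \<le>o |X + Y| \<or>
    (\<exists>y\<in>Y \<inter> semigroup_units. X + (Y + Y) = X + Y + {y})"
proof -
  define m where "m = min (gamma Y) (ecard Y - 1)"
  let ?K = "{k. enat k < m}"
  have csum: "|X| +c cardinal_of_enat m = |X <+> ?K|"
    by (simp add: cardinal_of_enat_def csum_def Field_card_of)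
  have XleXY: "|X| \<le>o |X + Y|" using assms(2) by (blast intro: card_le_card_plus)
  have comm: "a + b = b + a" if "a \<in> Y" "b \<in> Y" for a b
    using that assms(1) by (blast intro: subsemigroup_gen.base)
  \<comment> \<open>The supremum in \<open>gamma\<close> may be infinite without being attained, so
    the unit is sought for each \<open>k\<close> strictly below \<open>m\<close>. For such
    \<open>k\<close> to exist, \<open>Y\<close> must have more than one element, which selects the
    second branch of \<open>gamma\<close>.\<close>
  have unit: "\<exists>u\<in>Y \<inter> semigroup_units. \<forall>y\<in>Y - {u}. enat (Suc k) \<le> semigroup_ord {y + unit_inv u}"
    if "enat k < m" for k
  proof -
    have "\<not> ecard Y \<le> 1"
    proof
      assume "ecard Y \<le> 1"
      then have "ecard Y - 1 = 0"
        by (cases "ecard Y") (auto simp: one_enat_def zero_enat_def)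
      then show False using that by (simp add: m_def)
    qed
    then have "enat k < (SUP u \<in> Y \<inter> semigroup_units. INF y \<in> Y - {u}. semigroup_ord {y + unit_inv u})"
      using that by (simp add: m_def gamma_def)
    then obtain u where "u \<in> Y \<inter> semigroup_units"
      and "enat k < (INF y \<in> Y - {u}. semigroup_ord {y + unit_inv u})"
      by (auto simp: less_SUP_iff)
    then show ?thesis
      by (meson INF_lower Suc_ile_eq order_less_le_trans)
  qed
  have "|X <+> ?K| \<le>o |X + Y| \<or> (\<exists>y\<in>Y \<inter> semigroup_units. X + (Y + Y) = X + Y + {y})"
  proof (cases "m = 0")
    case True
    then have "?K = {}" by simp
    then have "|X <+> ?K| =o |X|"
      by (metis card_of_Plus_empty1 ordIso_symmetric)
    then show ?thesis using XleXY ordIso_ordLeq_trans by blast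
  next
    case False
    show ?thesis
    proof (cases "finite (X + Y)")
      case inf: False
      have "|?K| \<le>o |UNIV :: nat set|" by (rule card_of_mono1) simp
      also have "|UNIV :: nat set| \<le>o |X + Y|" using inf by (simp flip: infinite_iff_card_of_nat)
      finally have "|?K| \<le>o |X + Y|" .
      \<comment> \<open>An infinite cardinal absorbs the sum of two cardinals below it.\<close>
      then have "|X <+> ?K| \<le>o |X + Y|"
        using inf XleXY
        by (intro card_of_Plus_ordLeq_infinite_Field) (simp_all add: Field_card_of card_of_card_order_on)
      then show ?thesis ..
    next
      case fin: True
      show ?thesis
      proof (cases "X = {}")
        case True
        \<comment> \<open>With \<open>X\<close> empty both sides of the second alternative are
          empty; only a unit in \<open>Y\<close> is needed, and \<open>m \<noteq> 0\<close> provides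
          one.\<close>
        obtain u where "u \<in> Y \<inter> semigroup_units"
          using unit[of 0] False by (auto simp: zero_enat_def[symmetric])
        then show ?thesis using True by (auto simp: set_plus_def)
      next
        case nonempty: False
        have finX: "finite X" and finY: "finite Y"
          using finite_of_finite_plus[OF fin nonempty assms(2)] by auto
        have "m \<le> enat (card Y - 1)"
          using finY by (auto simp: m_def ecard_def one_enat_def min.coboundedI2)
        then obtain n where n: "m = enat n" "n \<le> card Y - 1"
          by (cases m) auto
        \<comment> \<open>Now \<open>m\<close> is finite and positive, so applying
          \<open>unit\<close> to its predecessor gives a unit with all orders at least
          \<open>m\<close> itself.\<close>
        obtain k where k: "n = Suc k" using False n(1) by (cases n) (auto simp: zero_enat_def)
        obtain u where u: "u \<in> Y" "u \<in> semigroup_units"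
          and ord: "\<And>y. y \<in> Y - {u} \<Longrightarrow> enat n \<le> semigroup_ord {y + unit_inv u}"
          using unit[of k] n(1) k by auto
        show ?thesis
        proof (cases "X + (Y + Y) = X + Y + {u}")
          case True
          then show ?thesis using u by blast
        next
          case neq: False
          have "card X + n \<le> card (X + Y)"
            using card_plus_ge_unit[OF finX finY u comm ord neq] n(2) by (simp add: min_absorb1)
          moreover have "?K = {..<n}" using n(1) by auto
          ultimately have "|X <+> ?K| \<le>o |X + Y|"
            using finX fin by (simp add: inj_on_iff_card_le card_Plus flip: card_of_ordLeq)
          then show ?thesis ..
        qed
      qed
    qed
  qed
  then show ?thesis using csum by (simp add: m_def)
qed

end
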